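(* Let $q$ be a prime power and let $k$ and $n$ be positive integers such that $k\mid n$. Let $U,W$ be two $m$-dimensional $\mathbb{F}_q$-subspaces of $\mathbb{F}_{q^k}^2$. Let $\gamma,\xi\in\mathbb{F}_{q^n}$ be such that $\{1,\gamma\}$ and $\{1,\xi\}$ are each $\mathbb{F}_{q^k}$-linearly independent, and let $$V_{U,\gamma}=\{u+u'\gamma : (u,u')\in U\},\qquad V_{W,\xi}=\{w+w'\xi : (w,w')\in W\}.$$ Suppose that neither $V_{U,\gamma}$ nor $V_{W,\xi}$ is contained in a multiplicative coset $\alpha\mathbb{F}_{q^k}$ $(\alpha\in\mathbb{F}_{q^n})$ of $\mathbb{F}_{q^k}$. Let $(\lambda,\sigma)\in\mathbb{F}_{q^n}^*\times\mathrm{Aut}(\mathbb{F}_{q^n})$. Then $V_{U,\gamma}$ and $V_{W,\xi}$ are semilinearly equivalent under the action of $(\lambda,\sigma)$, i.e. $\lambda V_{U,\gamma}^{\sigma}=V_{W,\xi}$, if and only if there exists $$A=\begin{pmatrix} c & d\\ a & b\end{pmatrix}\in\mathrm{GL}(2,\mathbb{F}_{q^k})$$ such that $\xi=\dfrac{a+b\gamma^\sigma}{c+d\gamma^\sigma}$, $\lambda=\dfrac{1}{c+d\gamma^\sigma}$ and $U^\sigma=W\cdot A=\{wA : w\in W\}$.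
   Context: For $V\subseteq\mathbb{F}_{q^n}$ and $\sigma\in\mathrm{Aut}(\mathbb{F}_{q^n})$ (the group of all field automorphisms), $V^\sigma=\{v^\sigma : v\in V\}$. For $U\subseteq\mathbb{F}_{q^k}^2$, $U^\sigma=\{(u^\sigma,u'^\sigma) : (u,u')\in U\}$. Elements $w=(w_1,w_2)$ of $W$ are row vectors, and $wA$ is the usual product of a row vector with a matrix. *)

theory Defs
  imports "HOL-Analysis.Analysis" "HOL-Number_Theory.Prime_Powers"
begin

text \<open>
  The tower of finite fields of orders q, q^k, q^n is given by three finite field types
  with embeddings \<open>i :: 'f \<Rightarrow> 'k\<close> and \<open>j :: 'k \<Rightarrow> 'l\<close>.
  An embedding is a unital ring homomorphism (automatically injective).
\<close>

definition field_embedding :: "('a::field \<Rightarrow> 'b::field) \<Rightarrow> bool" where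
  "field_embedding h \<longleftrightarrow>
     h 1 = 1 \<and> (\<forall>x y. h (x + y) = h x + h y) \<and> (\<forall>x y. h (x * y) = h x * h y)"

definition field_aut :: "('a::field \<Rightarrow> 'a) \<Rightarrow> bool" where
  "field_aut s \<longleftrightarrow> field_embedding s \<and> bij s"

definition scale_elem :: "('a::field \<Rightarrow> 'b::field) \<Rightarrow> 'a \<Rightarrow> 'b \<Rightarrow> 'b" where
  "scale_elem h c x = h c * x"

definition scale_vec :: "('a::field \<Rightarrow> 'b::field) \<Rightarrow> 'a \<Rightarrow> 'b ^ 2 \<Rightarrow> 'b ^ 2" where
  "scale_vec h c v = h c *s v"

lemma vector_space_scale_elem:
  assumes "field_embedding h"
  shows "vector_space (scale_elem h)"
  using assms
  by unfold_locales (auto simp: field_embedding_def scale_elem_def algebra_simps)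

lemma vector_space_scale_vec:
  assumes "field_embedding h"
  shows "vector_space (scale_vec h)"
  using assms
  by unfold_locales (auto simp: field_embedding_def scale_vec_def vec_eq_iff algebra_simps)

text \<open>
  Independence of the family x, y; the condition \<open>x \<noteq> y\<close> is needed because the library
  notion is about sets, and the set \<open>{x, y}\<close> collapses when \<open>x = y\<close>.
\<close>

definition independent_pair :: "('a::field \<Rightarrow> 'b::field) \<Rightarrow> 'b \<Rightarrow> 'b \<Rightarrow> bool" where
  "independent_pair h x y \<longleftrightarrow> x \<noteq> y \<and> \<not> module.dependent (scale_elem h) {x, y}"

definition subspace_of_dim ::
    "('a::field \<Rightarrow> 'b::field) \<Rightarrow> nat \<Rightarrow> ('b ^ 2) set \<Rightarrow> bool" where
  "subspace_of_dim h m U \<longleftrightarrow>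
     module.subspace (scale_vec h) U \<and> vector_space.dim (scale_vec h) U = m"

definition V_set :: "('k::field \<Rightarrow> 'l::field) \<Rightarrow> ('k ^ 2) set \<Rightarrow> 'l \<Rightarrow> 'l set" where
  "V_set j U g = {j (u $ 1) + j (u $ 2) * g | u. u \<in> U}"

definition mult_coset :: "('k::field \<Rightarrow> 'l::field) \<Rightarrow> 'l \<Rightarrow> 'l set" where
  "mult_coset j \<alpha> = {\<alpha> * j x | x. True}"

definition map_vec2 :: "('a \<Rightarrow> 'b) \<Rightarrow> 'a ^ 2 \<Rightarrow> 'b ^ 2" where
  "map_vec2 f v = (\<chi> r. f (v $ r))"

end

theory Submission
  imports Defs
begin

text \<open>
  Write \<open>K\<close> for \<open>range j\<close>. As a subfield of a finite field is determined by its order, \<open>\<sigma>\<close> maps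
  \<open>K\<close> onto itself. Since \<open>V_set j W \<xi>\<close> lies in no coset of \<open>K\<close>, it spans \<open>K + K\<xi>\<close> over \<open>K\<close>. If
  \<open>\<lambda> V\<^sub>U\<^sup>\<sigma> = V\<^sub>W\<close>, then \<open>K + K\<xi> \<subseteq> \<lambda> (K + K\<gamma>\<^sup>\<sigma>)\<close>, and expanding \<open>1\<close> and \<open>\<xi>\<close> in the basis
  \<open>\<lambda>, \<lambda>\<gamma>\<^sup>\<sigma>\<close> gives the rows of \<open>A\<close>. Given such an \<open>A\<close>, the \<open>K\<close>-linear injection
  \<open>(x, y) \<mapsto> \<lambda> (x + y\<gamma>\<^sup>\<sigma>)\<close> sends \<open>U\<^sup>\<sigma>\<close> to \<open>\<lambda> V\<^sub>U\<^sup>\<sigma>\<close> and \<open>W A\<close> to \<open>V\<^sub>W\<close>.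
\<close>

lemma field_embedding_simps:
  assumes "field_embedding h"
  shows "h 1 = 1" "h 0 = 0" "h (x + y) = h x + h y" "h (x * y) = h x * h y"
    "h (- x) = - h x" "h (x - y) = h x - h y" "h (x ^ N) = h x ^ N"
    "h (inverse x) = inverse (h x)" "h x = h y \<longleftrightarrow> x = y"
proof -
  show one: "h 1 = 1" and add: "h (x + y) = h x + h y" and mult: "h (x * y) = h x * h y" for x y
    using assms by (auto simp: field_embedding_def)
  show zero: "h 0 = 0"
    using add[of 0 0] by (metis add_0 add_cancel_right_left)
  show minus: "h (- x) = - h x" for x
    using add[of x "- x"] zero by (simp add: eq_neg_iff_add_eq_0 add.commute)
  show diff: "h (x - y) = h x - h y" for x y
    using add[of x "- y"] minus by simp
  show "h (x ^ N) = h x ^ N"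
    by (induction N) (auto simp: one mult)
  \<comment> \<open>Nonzero elements have invertible, hence nonzero, images; this yields both
    compatibility with \<open>inverse\<close> and injectivity.\<close>
  have inv: "h x * h (inverse x) = 1" if "x \<noteq> 0" for x
    using that by (simp add: one flip: mult)
  show "h (inverse x) = inverse (h x)"
    using inverse_unique[OF inv] zero by (cases "x = 0") simp_all
  show "h x = h y \<longleftrightarrow> x = y"
  proof
    assume "h x = h y"
    then show "x = y"
      using inv[of "x - y"] by (auto simp: diff)
  qed simp
qed

text \<open>Multiplication by a nonzero \<open>x\<close> permutes the nonzero elements; comparing
  their products gives \<open>x ^ card ?S = 1\<close>.\<close>

lemma finite_field_power_card:
  fixes x :: "'k::{field,finite}"
  shows "x ^ CARD('k) = x"
proof (cases "x = 0")
  case False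
  let ?S = "UNIV - {0 :: 'k}"
  have "bij_betw ((*) x) ?S ?S"
    by (rule bij_betwI[of _ _ _ "\<lambda>y. y / x"]) (use False in auto)
  then have "(\<Prod>y\<in>?S. x * y) = \<Prod>?S"
    using prod.reindex_bij_betw[of "(*) x" ?S ?S "\<lambda>y. y"] by simp
  then have "x ^ card ?S * \<Prod>?S = \<Prod>?S"
    by (simp add: prod.distrib)
  moreover have "\<Prod>?S \<noteq> 0"
    by simp
  ultimately have "x ^ card ?S = 1"
    by simp
  moreover have "CARD('k) = Suc (card ?S)"
    by (simp add: card_Diff_singleton)
  ultimately show ?thesis
    by (metis mult.right_neutral power_Suc)
qed (simp add: zero_power)

text \<open>The image consists of \<open>?N\<close> distinct roots of the polynomial X^N - X, which
  has at most \<open>?N\<close> roots.\<close>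

lemma range_field_embedding:
  fixes j :: "'k::{field,finite} \<Rightarrow> 'l::field"
  assumes "field_embedding j"
  shows "range j = {x. x ^ CARD('k) = x}"
proof -
  let ?N = "CARD('k)"
  let ?p = "monom 1 ?N - [:0, 1:] :: 'l poly"
  have "card {0, 1 :: 'k} \<le> ?N"
    by (rule card_mono) auto
  \<comment> \<open>With exponent at least 2, subtracting X leaves the leading coefficient 1 intact,
    so \<open>?p\<close> is nonzero.\<close>
  then have N: "2 \<le> ?N" by simp
  then have coeff: "coeff ?p ?N = 1"
    by (auto simp: coeff_pCons split: nat.split)
  then have p0: "?p \<noteq> 0"
    by (metis coeff_0 zero_neq_one)
  have deg: "degree ?p \<le> ?N"
    using N by (intro degree_diff_le degree_monom_le) auto
  have roots: "{x. poly ?p x = 0} = {x. x ^ ?N = x}"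
    by (simp add: poly_monom)
  show ?thesis
  proof (rule card_seteq)
    show "finite {x :: 'l. x ^ ?N = x}"
      using poly_roots_finite[OF p0] roots by simp
    show "range j \<subseteq> {x. x ^ ?N = x}"
      by (auto simp: finite_field_power_card simp flip: field_embedding_simps(7)[OF assms])
    have "inj j"
      using field_embedding_simps(9)[OF assms] by (auto intro: injI)
    then have "card (range j) = ?N"
      by (simp add: card_image)
    moreover have "card {x :: 'l. x ^ ?N = x} \<le> ?N"
      using card_poly_roots_bound[OF p0] deg roots by simp
    ultimately show "card {x :: 'l. x ^ ?N = x} \<le> card (range j)"
      by simp
  qed
qed

text \<open>Membership is the equation \<open>x ^ CARD('k) = x\<close>, which an injective
  homomorphism preserves and reflects.\<close>

lemma field_embedding_mem_range_iff:
  fixes j :: "'k::{field,finite} \<Rightarrow> 'l::field"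
  assumes "field_embedding j" "field_embedding \<sigma>"
  shows "\<sigma> x \<in> range j \<longleftrightarrow> x \<in> range j"
  unfolding range_field_embedding[OF assms(1)] mem_Collect_eq
  by (simp flip: field_embedding_simps(7)[OF assms(2)] add: field_embedding_simps(9)[OF assms(2)])

lemma independent_pair_one_not_in_range:
  assumes "field_embedding j" "independent_pair j 1 \<gamma>"
  shows "\<gamma> \<notin> range j"
proof
  assume "\<gamma> \<in> range j"
  then obtain x where x: "\<gamma> = scale_elem j x 1"
    by (auto simp: scale_elem_def)
  interpret vector_space "scale_elem j"
    using assms(1) by (rule vector_space_scale_elem)
  \<comment> \<open>Since \<open>1 \<noteq> \<gamma>\<close>, removing \<open>\<gamma>\<close>
    leaves \<open>1\<close>, of which \<open>\<gamma>\<close> is a scalar multiple.\<close>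
  have "\<gamma> \<in> span ({1, \<gamma>} - {\<gamma>})"
    using assms(2) unfolding x by (intro span_scale span_base) (auto simp: independent_pair_def x)
  then show False
    using assms(2) by (auto simp: independent_pair_def dependent_def)
qed

lemma coordinates_unique:
  assumes j: "field_embedding j" and g: "g \<notin> range j"
    and eq: "j a + j b * g = j c + j d * g"
  shows "a = c" "b = d"
proof -
  note [simp] = field_embedding_simps[OF j]
  have *: "j (a - c) = j (d - b) * g"
    using eq by (simp add: algebra_simps)
  show "b = d"
  proof (rule ccontr)
    assume "b \<noteq> d"
    then have "j (d - b) \<noteq> 0"
      by simp
    then have "g = j ((a - c) * inverse (d - b))"
      unfolding field_embedding_simps(4,8)[OF j] * by simp
    then show False
      using g by blast
  qed
  then show "a = c"
    using * by simp
qed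

text \<open>If all these determinants vanish, every vector of \<open>W\<close> is a multiple of one
  nonzero \<open>u\<close>, so \<open>V_set j W \<xi>\<close> lies in the coset of the element given
  by \<open>u\<close>; without such a \<open>u\<close>, the coset of 0 suffices.\<close>

lemma not_in_coset_obtains_basis:
  assumes j: "field_embedding j"
    and "\<not> (\<exists>\<alpha>. V_set j W \<xi> \<subseteq> mult_coset j \<alpha>)"
  obtains u v where "u \<in> W" "v \<in> W" "u $ 1 * v $ 2 - u $ 2 * v $ 1 \<noteq> 0"
proof (rule ccontr)
  note [simp] = field_embedding_simps[OF j]
  assume "\<not> thesis"
  with that have det: "u $ 1 * v $ 2 = u $ 2 * v $ 1" if "u \<in> W" "v \<in> W" for u v
    using \<open>u \<in> W\<close> \<open>v \<in> W\<close> by force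
  have "\<exists>\<alpha>. V_set j W \<xi> \<subseteq> mult_coset j \<alpha>"
  proof (cases "\<exists>u\<in>W. u $ 1 \<noteq> 0 \<or> u $ 2 \<noteq> 0")
    case False
    then have "V_set j W \<xi> \<subseteq> mult_coset j 0"
      by (auto simp: V_set_def mult_coset_def)
    then show ?thesis ..
  next
    case True
    then obtain u where u: "u \<in> W" "u $ 1 \<noteq> 0 \<or> u $ 2 \<noteq> 0"
      by blast
    have "\<exists>t. v $ 1 = t * u $ 1 \<and> v $ 2 = t * u $ 2" if "v \<in> W" for v
      using det[OF u(1) that] u(2)
      by (intro exI[of _ "if u $ 1 \<noteq> 0 then v $ 1 / u $ 1 else v $ 2 / u $ 2"])
        (auto simp: field_simps)
    then have "\<exists>t. j (v $ 1) + j (v $ 2) * \<xi> = (j (u $ 1) + j (u $ 2) * \<xi>) * j t" if "v \<in> W" for v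
      using that by (fastforce simp: algebra_simps)
    then have "V_set j W \<xi> \<subseteq> mult_coset j (j (u $ 1) + j (u $ 2) * \<xi>)"
      by (auto simp: V_set_def mult_coset_def)
    then show ?thesis ..
  qed
  with assms(2) show False ..
qed

lemma field_coordinates_of_spanning_set:
  fixes j :: "'k::field \<Rightarrow> 'l::field"
  assumes j: "field_embedding j"
    and W: "\<not> (\<exists>\<alpha>. V_set j W \<xi> \<subseteq> mult_coset j \<alpha>)"
    and sub: "V_set j W \<xi> \<subseteq> {l * (j x + j y * g) | x y. True}"
  shows "\<exists>c d. j r + j s * \<xi> = l * (j c + j d * g)"
proof -
  note [simp] = field_embedding_simps[OF j]
  obtain u v where uv: "u \<in> W" "v \<in> W" and "u $ 1 * v $ 2 - u $ 2 * v $ 1 \<noteq> 0"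
    using not_in_coset_obtains_basis[OF j W] .
  moreover define D where "D = u $ 1 * v $ 2 - u $ 2 * v $ 1"
  ultimately have D: "D \<noteq> 0" by simp
  \<comment> \<open>Cramer's rule for writing \<open>(r, s)\<close> as \<open>p\<close> times
    \<open>u\<close> plus \<open>t\<close> times \<open>v\<close>.\<close>
  define p where "p = (r * v $ 2 - s * v $ 1) * inverse D"
  define t where "t = (s * u $ 1 - r * u $ 2) * inverse D"
  have "p * u $ 1 + t * v $ 1 = r * (D * inverse D)" "p * u $ 2 + t * v $ 2 = s * (D * inverse D)"
    unfolding p_def t_def D_def by algebra+
  then have r: "r = p * u $ 1 + t * v $ 1" and s: "s = p * u $ 2 + t * v $ 2"
    using D by simp_all
  obtain x y where u: "j (u $ 1) + j (u $ 2) * \<xi> = l * (j x + j y * g)"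
    using sub uv(1) unfolding V_set_def by blast
  obtain x' y' where v: "j (v $ 1) + j (v $ 2) * \<xi> = l * (j x' + j y' * g)"
    using sub uv(2) unfolding V_set_def by blast
  have "j r + j s * \<xi> = j p * (j (u $ 1) + j (u $ 2) * \<xi>) + j t * (j (v $ 1) + j (v $ 2) * \<xi>)"
    unfolding r s by (simp add: algebra_simps)
  also have "\<dots> = l * (j (p * x + t * x') + j (p * y + t * y') * g)"
    unfolding u v by (simp add: algebra_simps)
  finally show ?thesis by blast
qed

text \<open>If the determinant vanishes, so do \<open>j c * \<xi> - j a\<close> and
  \<open>j d * \<xi> - j b\<close>. As \<open>\<xi>\<close> is outside \<open>range j\<close>, this
  forces \<open>c = d = 0\<close>, against \<open>1 = l * (j c + j d * g)\<close>.\<close>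

lemma change_of_basis_invertible:
  fixes j :: "'k::field \<Rightarrow> 'l::field"
  assumes j: "field_embedding j" and \<xi>: "\<xi> \<notin> range j"
    and one: "1 = l * (j c + j d * g)" and xi: "\<xi> = l * (j a + j b * g)"
  shows "invertible (vector [vector [c, d], vector [a, b]] :: 'k ^ 2 ^ 2)"
proof (rule ccontr)
  note [simp] = field_embedding_simps[OF j]
  assume "\<not> ?thesis"
  then have "c * b = d * a"
    by (simp add: invertible_det_nz det_2)
  then have eq: "j c * j b = j d * j a"
    by (metis field_embedding_simps(4)[OF j])
  have "j (- a) + j c * \<xi> = j c * \<xi> - j a * (l * (j c + j d * g))"
    by (simp flip: one)
  also have "\<dots> = l * g * (j c * j b - j d * j a)"
    unfolding xi by (simp add: algebra_simps)
  finally have "j (- a) + j c * \<xi> = j 0 + j 0 * \<xi>"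
    using eq by simp
  then have "c = 0"
    using coordinates_unique(2)[OF j \<xi>] by blast
  have "j (- b) + j d * \<xi> = j d * \<xi> - j b * (l * (j c + j d * g))"
    by (simp flip: one)
  also have "\<dots> = l * (j d * j a - j c * j b)"
    unfolding xi by (simp add: algebra_simps)
  finally have "j (- b) + j d * \<xi> = j 0 + j 0 * \<xi>"
    using eq by simp
  then have "d = 0"
    using coordinates_unique(2)[OF j \<xi>] by blast
  with \<open>c = 0\<close> one show False
    by simp
qed

lemma semilinear_equivalence_iff_image:
  fixes j :: "'k::{field,finite} \<Rightarrow> 'l::field"
  assumes j: "field_embedding j" and \<sigma>: "field_embedding \<sigma>"
    and g: "\<sigma> \<gamma> \<notin> range j" and "l \<noteq> 0"
    and one: "1 = l * (j c + j d * \<sigma> \<gamma>)" and xi: "\<xi> = l * (j a + j b * \<sigma> \<gamma>)"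
  shows "(*) l ` (\<sigma> ` V_set j U \<gamma>) = V_set j W \<xi> \<longleftrightarrow>
    (\<lambda>u. map_vec2 \<sigma> (map_vec2 j u)) ` U =
      (\<lambda>w. map_vec2 j (w v* vector [vector [c, d], vector [a, b]])) ` W"
    (is "_ \<longleftrightarrow> ?P ` U = ?Q ` W")
proof -
  note [simp] = field_embedding_simps[OF j] field_embedding_simps[OF \<sigma>]
  define \<Phi> :: "'l ^ 2 \<Rightarrow> 'l" where "\<Phi> z = l * (z $ 1 + z $ 2 * \<sigma> \<gamma>)" for z
  \<comment> \<open>Since \<open>\<sigma>\<close> acts on the large field, both sides are compared
    in \<open>'l ^ 2\<close>. Injectivity of \<open>\<Phi>\<close> comes from uniqueness of
    coordinates, hence the restriction to pairs over \<open>range j\<close>.\<close>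
  define R :: "('l ^ 2) set" where "R = {z. \<forall>r. z $ r \<in> range j}"
  have inj: "inj_on \<Phi> R"
  proof (rule inj_onI)
    fix y z assume "y \<in> R" "z \<in> R" and eq: "\<Phi> y = \<Phi> z"
    then obtain p q r s where "y $ 1 = j p" "y $ 2 = j q" "z $ 1 = j r" "z $ 2 = j s"
      unfolding R_def by blast
    then show "y = z"
      using eq coordinates_unique[OF j g, of p q r s] \<open>l \<noteq> 0\<close>
      by (auto simp: \<Phi>_def vec_eq_iff forall_2)
  qed
  have P: "?P ` U \<subseteq> R"
    using field_embedding_mem_range_iff[OF j \<sigma>] by (auto simp: R_def map_vec2_def)
  have Q: "?Q ` W \<subseteq> R"
    by (auto simp: R_def map_vec2_def)
  have "\<Phi> (?P u) = l * \<sigma> (j (u $ 1) + j (u $ 2) * \<gamma>)" for u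
    by (simp add: \<Phi>_def map_vec2_def)
  then have "\<Phi> ` ?P ` U = (*) l ` (\<sigma> ` V_set j U \<gamma>)"
    by (simp add: V_set_def image_image setcompr_eq_image)
  moreover have "\<Phi> (?Q w) = j (w $ 1) + j (w $ 2) * \<xi>" for w
  proof -
    have "\<Phi> (?Q w) = j (w $ 1) * (l * (j c + j d * \<sigma> \<gamma>)) + j (w $ 2) * (l * (j a + j b * \<sigma> \<gamma>))"
      by (simp add: \<Phi>_def map_vec2_def vector_matrix_mult_def sum_2 algebra_simps)
    then show ?thesis
      by (simp flip: one xi)
  qed
  then have "\<Phi> ` ?Q ` W = V_set j W \<xi>"
    by (simp add: V_set_def image_image setcompr_eq_image)
  ultimately show ?thesis
    using inj_on_image_eq_iff[OF inj P Q] by simp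
qed

theorem theorem6p2:
  fixes q k n m :: nat
    and i :: "'f::{field,finite} \<Rightarrow> 'k::{field,finite}"
    and j :: "'k \<Rightarrow> 'l::{field,finite}"
    and U W :: "('k ^ 2) set"
    and \<gamma> \<xi> l :: 'l
    and \<sigma> :: "'l \<Rightarrow> 'l"
  assumes "primepow q" and "0 < k" and "0 < n" and "k dvd n"
    and "CARD('f) = q" and "CARD('k) = q ^ k" and "CARD('l) = q ^ n"
    and "field_embedding i" and "field_embedding j"
    and "subspace_of_dim i m U" and "subspace_of_dim i m W"
    and "independent_pair j 1 \<gamma>" and "independent_pair j 1 \<xi>"
    and "\<not> (\<exists>\<alpha>. V_set j U \<gamma> \<subseteq> mult_coset j \<alpha>)"
    and "\<not> (\<exists>\<alpha>. V_set j W \<xi> \<subseteq> mult_coset j \<alpha>)"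
    and "l \<noteq> 0" and "field_aut \<sigma>"
  shows "(*) l ` (\<sigma> ` V_set j U \<gamma>) = V_set j W \<xi> \<longleftrightarrow>
    (\<exists>(A :: 'k ^ 2 ^ 2) a b c d.
       A = vector [vector [c, d], vector [a, b]] \<and> invertible A \<and>
       \<xi> = (j a + j b * \<sigma> \<gamma>) / (j c + j d * \<sigma> \<gamma>) \<and>
       l = 1 / (j c + j d * \<sigma> \<gamma>) \<and>
       (\<lambda>u. map_vec2 \<sigma> (map_vec2 j u)) ` U = (\<lambda>w. map_vec2 j (w v* A)) ` W)"
proof -
  note j = \<open>field_embedding j\<close>
  have \<sigma>: "field_embedding \<sigma>"
    using \<open>field_aut \<sigma>\<close> by (simp add: field_aut_def)
  have \<xi>: "\<xi> \<notin> range j" and "\<gamma> \<notin> range j"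
    using independent_pair_one_not_in_range j assms by blast+
  then have g: "\<sigma> \<gamma> \<notin> range j"
    using field_embedding_mem_range_iff[OF j \<sigma>] by blast
  note iff = semilinear_equivalence_iff_image[OF j \<sigma> g \<open>l \<noteq> 0\<close>]
  show ?thesis (is "?L \<longleftrightarrow> ?R")
  proof
    assume L: ?L
    \<comment> \<open>Because \<open>\<sigma>\<close> preserves \<open>range j\<close>, the
      conjugated coordinates of vectors of \<open>U\<close> are again images under
      \<open>j\<close>.\<close>
    have "V_set j W \<xi> \<subseteq> {l * (j x + j y * \<sigma> \<gamma>) | x y. True}"
    proof
      fix z assume "z \<in> V_set j W \<xi>"
      then obtain u :: "'k ^ 2" where z: "z = l * (\<sigma> (j (u $ 1)) + \<sigma> (j (u $ 2)) * \<sigma> \<gamma>)"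
        unfolding L[symmetric] by (fastforce simp: V_set_def field_embedding_simps[OF \<sigma>])
      have "\<sigma> (j x) \<in> range j" for x
        using field_embedding_mem_range_iff[OF j \<sigma>] by blast
      then obtain x y where "\<sigma> (j (u $ 1)) = j x" "\<sigma> (j (u $ 2)) = j y"
        by (meson imageE)
      with z show "z \<in> {l * (j x + j y * \<sigma> \<gamma>) | x y. True}"
        by auto
    qed
    note coords = field_coordinates_of_spanning_set
      [OF j \<open>\<not> (\<exists>\<alpha>. V_set j W \<xi> \<subseteq> mult_coset j \<alpha>)\<close> this]
    \<comment> \<open>The coordinate pairs \<open>(1, 0)\<close> and \<open>(0, 1)\<close> stand for
      \<open>1\<close> and \<open>\<xi>\<close>; their expansions are the two rows of the
      matrix.\<close>
    obtain c d where one: "1 = l * (j c + j d * \<sigma> \<gamma>)"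
      using coords[of 1 0] by (auto simp: field_embedding_simps[OF j])
    obtain a b where xi: "\<xi> = l * (j a + j b * \<sigma> \<gamma>)"
      using coords[of 0 1] by (auto simp: field_embedding_simps[OF j])
    have "j c + j d * \<sigma> \<gamma> \<noteq> 0"
      using one by auto
    then have l: "l = 1 / (j c + j d * \<sigma> \<gamma>)"
      by (metis one nonzero_eq_divide_eq)
    from l xi have div: "\<xi> = (j a + j b * \<sigma> \<gamma>) / (j c + j d * \<sigma> \<gamma>)"
      by simp
    show ?R
      by (rule exI conjI refl div l change_of_basis_invertible[OF j \<xi> one xi]
          iff[OF one xi, THEN iffD1, OF L])+
  next
    assume ?R
    then obtain a b c d where xi: "\<xi> = (j a + j b * \<sigma> \<gamma>) / (j c + j d * \<sigma> \<gamma>)"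
      and l: "l = 1 / (j c + j d * \<sigma> \<gamma>)"
      and im: "(\<lambda>u. map_vec2 \<sigma> (map_vec2 j u)) ` U =
        (\<lambda>w. map_vec2 j (w v* vector [vector [c, d], vector [a, b]])) ` W"
      by blast
    \<comment> \<open>A zero denominator would give \<open>l = 0\<close>, division by zero being
      0.\<close>
    have "1 = l * (j c + j d * \<sigma> \<gamma>)"
      using l \<open>l \<noteq> 0\<close> by auto
    moreover have "\<xi> = l * (j a + j b * \<sigma> \<gamma>)"
      using xi l by simp
    ultimately show ?L
      by (rule iff[THEN iffD2, OF _ _ im])
  qed
qed

end
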